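(* Let $(x_h^m)_{m=0,\dots,M}\subset\underline{V}^h$ be any solution of the scheme: $x_h^0=Q_hx_0$ and, for $m=0,\dots,M-1$, $$\frac1{\Delta t}\int_I H(x^m_{h,\rho})(x_h^{m+1}-x_h^m)\cdot\eta_h\,\mathrm{d}\rho+\int_I\Phi'(x^{m+1}_{h,\rho})\cdot\eta_{h,\rho}\,\mathrm{d}\rho=0\qquad\forall\ \eta_h\in\underline{V}^h.$$ Then it satisfies the energy estimate $$\int_I\Phi(x^{m+1}_{h,\rho})\,\mathrm{d}\rho+\frac1{\Delta t}\int_I H(x^m_{h,\rho})(x_h^{m+1}-x_h^m)\cdot(x_h^{m+1}-x_h^m)\,\mathrm{d}\rho\le\int_I\Phi(x^m_{h,\rho})\,\mathrm{d}\rho$$ for $m=0,\dots,M-1$.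
   Context: Let $d\ge2$. The anisotropy $\phi\in C^0(\mathbb{R}^d,\mathbb{R}_{\ge0})\cap C^4(\mathbb{R}^d\setminus\{0\},\mathbb{R}_{>0})$ satisfies $\phi(\lambda p)=|\lambda|\phi(p)$ for all $p\in\mathbb{R}^d$, $\lambda\in\mathbb{R}$, and $\phi''(p)q\cdot q>0$ for all $p,q\in\mathbb{R}^d$ with $|p|=|q|=1$, $p\cdot q=0$; primes denote gradient and Hessian. $\Phi(p)=\tfrac12\phi^2(p)$, which belongs to $C^1(\mathbb{R}^d)\cap C^4(\mathbb{R}^d\setminus\{0\})$. The mobility $\mathfrak{m}:\mathbb{S}^{d-1}\to\mathbb{R}_{>0}$ is extended $0$-homogeneously to $\mathbb{R}^d\setminus\{0\}$, with $\mathfrak{m}\in C^3(\mathbb{R}^d\setminus\{0\})$. For $p\in\mathbb{R}^d\setminus\{0\}$, $$H(p)=\alpha(p)\left[\mathrm{Id}+\frac{w(p)\otimes(\frac{p}{|p|}-w(p))-\frac{p}{|p|}\otimes(w(p)+|w(p)|^2\frac{p}{|p|})}{1+|w(p)|^2}\right],$$ with $\alpha(p)=\mathfrak{m}(p)|p|\phi(p)$ and $w(p)=\frac{|p|}{\phi(p)}\phi'(p)-\frac{p}{|p|}$, where $a\otimes b=ab^T$. $I=\mathbb{R}/\mathbb{Z}$ is the periodic unit interval; subscript $\rho$ denotes the derivative in $\rho\in I$. Mesh: $0=q_0<q_1<\dots<q_J=1$, $I_j=[q_{j-1},q_j]$, $h_j=q_j-q_{j-1}$, $h=\max_jh_j$,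 with $h\le c\,h_j$ for all $j$ for a fixed constant $c>0$; $q_J$ is identified with $q_0$. $V^h=\{\chi\in C^0(I):\chi|_{I_j}\text{ is affine},\ j=1,\dots,J\}$, $\underline{V}^h=[V^h]^d$. Time step: $\Delta t=T/M>0$ with $T>0$ and $M$ a positive integer. Initial datum: $x_0\in[W^{2,\infty}(I)]^d$ with $|x_{0,\rho}|$ bounded below by a positive constant, and $Q_hx_0\in\underline{V}^h$ is the unique function with $\int_I\Phi''(x_{0,\rho})(Q_hx_0-x_0)_\rho\cdot\eta_{h,\rho}\,\mathrm{d}\rho+\int_I(Q_hx_0-x_0)\cdot\eta_h\,\mathrm{d}\rho=0$ for all $\eta_h\in\underline{V}^h$. A solution of the scheme is understood to satisfy $x^m_{h,\rho}\neq0$ a.e. in $I$ for $m=0,\dots,M-1$, so that $H(x^m_{h,\rho})$ is defined. *)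

theory Defs
  imports "HOL-Analysis.Analysis"
begin

section \<open>Differential calculus\<close>

text \<open>\<open>Ck k f S\<close> is \<open>f \<in> C\<^sup>k(S)\<close>; it is meant for open \<open>S\<close>, since the derivatives are full
  derivatives in the ambient space.\<close>

fun Ck :: "nat \<Rightarrow> ('a::euclidean_space \<Rightarrow> 'b::real_normed_vector) \<Rightarrow> 'a set \<Rightarrow> bool" where
  "Ck 0 f S \<longleftrightarrow> continuous_on S f"
| "Ck (Suc k) f S \<longleftrightarrow> (\<forall>x\<in>S. f differentiable (at x)) \<and>
     (\<forall>b\<in>Basis. Ck k (\<lambda>x. frechet_derivative f (at x) b) S)"

definition grad :: "(real^'n \<Rightarrow> real) \<Rightarrow> real^'n \<Rightarrow> real^'n" where
  "grad f p = (\<chi> i. frechet_derivative f (at p) (axis i 1))"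

definition hess :: "(real^'n \<Rightarrow> real) \<Rightarrow> real^'n \<Rightarrow> real^'n^'n" where
  "hess f p = jacobian (grad f) (at p)"

definition outer :: "real^'n \<Rightarrow> real^'n \<Rightarrow> real^'n^'n" where
  "outer a b = (\<chi> i j. a $ i * b $ j)"


section \<open>Anisotropy, mobility and the matrix \<open>H\<close>\<close>

definition anisotropy :: "(real^'n \<Rightarrow> real) \<Rightarrow> bool" where
  "anisotropy \<phi> \<longleftrightarrow>
     continuous_on UNIV \<phi> \<and> (\<forall>p. 0 \<le> \<phi> p) \<and>
     Ck 4 \<phi> (UNIV - {0}) \<and> (\<forall>p. p \<noteq> 0 \<longrightarrow> 0 < \<phi> p) \<and>
     (\<forall>p l. \<phi> (l *\<^sub>R p) = \<bar>l\<bar> * \<phi> p) \<and>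
     (\<forall>p q. norm p = 1 \<longrightarrow> norm q = 1 \<longrightarrow> p \<bullet> q = 0 \<longrightarrow> 0 < (hess \<phi> p *v q) \<bullet> q)"

definition Phi :: "(real^'n \<Rightarrow> real) \<Rightarrow> real^'n \<Rightarrow> real" where
  "Phi \<phi> p = (\<phi> p)\<^sup>2 / 2"

text \<open>The mobility is given on the unit sphere; only these values of \<open>\<mm>\<close> enter below.\<close>

definition extend0 :: "(real^'n \<Rightarrow> real) \<Rightarrow> real^'n \<Rightarrow> real" where
  "extend0 \<mm> p = \<mm> (p /\<^sub>R norm p)"

definition mobility :: "(real^'n \<Rightarrow> real) \<Rightarrow> bool" where
  "mobility \<mm> \<longleftrightarrow> (\<forall>p\<in>sphere 0 1. 0 < \<mm> p) \<and> Ck 3 (extend0 \<mm>) (UNIV - {0})"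

definition alpha :: "(real^'n \<Rightarrow> real) \<Rightarrow> (real^'n \<Rightarrow> real) \<Rightarrow> real^'n \<Rightarrow> real" where
  "alpha \<phi> \<mm> p = extend0 \<mm> p * norm p * \<phi> p"

definition wvec :: "(real^'n \<Rightarrow> real) \<Rightarrow> real^'n \<Rightarrow> real^'n" where
  "wvec \<phi> p = (norm p / \<phi> p) *\<^sub>R grad \<phi> p - p /\<^sub>R norm p"

definition Hmat :: "(real^'n \<Rightarrow> real) \<Rightarrow> (real^'n \<Rightarrow> real) \<Rightarrow> real^'n \<Rightarrow> real^'n^'n" where
  "Hmat \<phi> \<mm> p =
     (let w = wvec \<phi> p; t = p /\<^sub>R norm p
      in alpha \<phi> \<mm> p *\<^sub>R
           (mat 1 + (outer w (t - w) - outer t (w + (norm w)\<^sup>2 *\<^sub>R t)) /\<^sub>R (1 + (norm w)\<^sup>2)))"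


section \<open>Functions on the periodic unit interval\<close>

text \<open>Functions on \<open>\<real>/\<int>\<close> are represented by 1-periodic functions on \<open>\<real>\<close>, and integrals over
  \<open>\<real>/\<int>\<close> by Lebesgue integrals over \<open>{0..1}\<close>.\<close>

definition periodic1 :: "(real \<Rightarrow> 'a) \<Rightarrow> bool" where
  "periodic1 f \<longleftrightarrow> (\<forall>\<rho>. f (\<rho> + 1) = f \<rho>)"

definition has_weak_deriv ::
  "(real \<Rightarrow> 'a::euclidean_space) \<Rightarrow> (real \<Rightarrow> 'a) \<Rightarrow> bool" where
  "has_weak_deriv f g \<longleftrightarrow>
     periodic1 f \<and> set_integrable lebesgue {0..1} f \<and>
     periodic1 g \<and> set_integrable lebesgue {0..1} g \<and>
     (\<forall>\<psi>::real \<Rightarrow> real. periodic1 \<psi> \<and> (\<forall>k. Ck k \<psi> UNIV) \<longrightarrow>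
        (LINT \<rho>:{0..1}|lebesgue. deriv \<psi> \<rho> *\<^sub>R f \<rho>)
          = - (LINT \<rho>:{0..1}|lebesgue. \<psi> \<rho> *\<^sub>R g \<rho>))"

text \<open>A weak derivative is unique almost everywhere; \<open>wderiv\<close> picks a representative.\<close>

definition wderiv :: "(real \<Rightarrow> 'a::euclidean_space) \<Rightarrow> real \<Rightarrow> 'a" where
  "wderiv f = (SOME g. has_weak_deriv f g)"

definition Linf :: "(real \<Rightarrow> 'a::euclidean_space) \<Rightarrow> bool" where
  "Linf f \<longleftrightarrow> periodic1 f \<and> f \<in> borel_measurable lebesgue \<and>
     (\<exists>C. AE \<rho> in lebesgue. norm (f \<rho>) \<le> C)"

fun Winf :: "nat \<Rightarrow> (real \<Rightarrow> 'a::euclidean_space) \<Rightarrow> bool" where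
  "Winf 0 f \<longleftrightarrow> Linf f"
| "Winf (Suc k) f \<longleftrightarrow> Linf f \<and> (\<exists>g. has_weak_deriv f g \<and> Winf k g)"


section \<open>Finite elements\<close>

definition mesh_size :: "nat \<Rightarrow> (nat \<Rightarrow> real) \<Rightarrow> real" where
  "mesh_size J q = Max ((\<lambda>j. q j - q (j - 1)) ` {1..J})"

definition mesh :: "real \<Rightarrow> nat \<Rightarrow> (nat \<Rightarrow> real) \<Rightarrow> bool" where
  "mesh c J q \<longleftrightarrow> q 0 = 0 \<and> q J = 1 \<and> strict_mono_on {0..J} q \<and>
     (\<forall>j\<in>{1..J}. mesh_size J q \<le> c * (q j - q (j - 1)))"

definition Vh :: "nat \<Rightarrow> (nat \<Rightarrow> real) \<Rightarrow> (real \<Rightarrow> real) set" where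
  "Vh J q = {v. continuous_on UNIV v \<and> periodic1 v \<and>
     (\<forall>j\<in>{1..J}. \<exists>a b. \<forall>\<rho>\<in>{q (j - 1)..q j}. v \<rho> = a + b * \<rho>)}"

definition Vhd :: "nat \<Rightarrow> (nat \<Rightarrow> real) \<Rightarrow> (real \<Rightarrow> real^'n) set" where
  "Vhd J q = {\<eta>. \<forall>i. (\<lambda>\<rho>. \<eta> \<rho> $ i) \<in> Vh J q}"

text \<open>The derivative of a finite element function, which is piecewise constant. At the finitely many
  mesh points, where the classical derivative need not exist, its value is irrelevant.\<close>

definition ddrho :: "(real \<Rightarrow> real^'n) \<Rightarrow> real \<Rightarrow> real^'n" where
  "ddrho f \<rho> = vector_derivative f (at \<rho>)"

definition Qh :: "(real^'n \<Rightarrow> real) \<Rightarrow> nat \<Rightarrow> (nat \<Rightarrow> real) \<Rightarrow> (real \<Rightarrow> real^'n) \<Rightarrow> real \<Rightarrow> real^'n" where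
  "Qh \<phi> J q x0 = (THE u. u \<in> Vhd J q \<and>
     (\<forall>\<eta>\<in>Vhd J q.
        (LINT \<rho>:{0..1}|lebesgue. (hess (Phi \<phi>) (wderiv x0 \<rho>) *v (ddrho u \<rho> - wderiv x0 \<rho>)) \<bullet> ddrho \<eta> \<rho>)
        + (LINT \<rho>:{0..1}|lebesgue. (u \<rho> - x0 \<rho>) \<bullet> \<eta> \<rho>) = 0))"

end

theory Submission
  imports Defs
begin

text \<open>
  Testing the scheme with the increment \<open>x\<^sub>h\<^sup>m\<^sup>+\<^sup>1 - x\<^sub>h\<^sup>m\<close>, which is again a finite element function,
  turns the mobility term into minus the integral of \<open>\<Phi>'(a) \<bullet> (a - b)\<close>, where \<open>a\<close> and \<open>b\<close> are the
  \<open>\<rho>\<close>-derivatives of \<open>x\<^sub>h\<^sup>m\<^sup>+\<^sup>1\<close> and \<open>x\<^sub>h\<^sup>m\<close>. The estimate is then the integrated form of the pointwise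
  tangent inequality \<open>\<Phi>(a) + \<Phi>'(a) \<bullet> (b - a) \<le> \<Phi>(b)\<close>, that is, of the convexity of \<open>\<Phi>\<close>
  (lemma \<open>Phi_above_tangent\<close>).

  This inequality comes from Fenchel's form of the convexity of \<open>\<phi>\<close>, namely
  \<open>\<phi>'(a) \<bullet> b \<le> \<phi>(b)\<close> (lemma \<open>grad_inner_le\<close>), by Young's inequality: \<open>\<Phi>' = \<phi> \<phi>'\<close> away from the
  origin and \<open>\<phi>'(a) \<bullet> a = \<phi>(a)\<close>. At the origin, where \<open>\<phi>\<close> is not differentiable, \<open>\<Phi>\<close> has a
  minimum with vanishing gradient.

  For the convexity of \<open>\<phi>\<close>, the hypothesis gives positivity of \<open>\<phi>''(p)\<close> only for unit \<open>p\<close> and in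
  directions orthogonal to \<open>p\<close>. Homogeneity supplies the rest: \<open>\<phi>''\<close> is homogeneous of degree
  \<open>-1\<close>, and \<open>\<phi>''(p)\<close> has \<open>p\<close> in its kernel and its range in the orthogonal complement of \<open>p\<close>.
  Hence \<open>\<phi>\<close> is convex along each line that misses the origin; on lines through the origin the
  inequality is immediate from homogeneity.

  The derivative of a finite element function is constant on each open mesh interval, so every
  function of such derivatives is a step function up to a null set, and integrable.
\<close>

section \<open>Gradients and Hessians\<close>

lemma has_derivative_grad:
  fixes f :: "real^'n \<Rightarrow> real"
  assumes "f differentiable (at p)"
  shows "(f has_derivative (\<lambda>h. grad f p \<bullet> h)) (at p)"
proof -
  let ?D = "frechet_derivative f (at p)"
  have D: "(f has_derivative ?D) (at p)"
    using assms frechet_derivative_works by blast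
  then have lin: "linear ?D"
    by (rule has_derivative_linear)
  have "?D h = grad f p \<bullet> h" for h
  proof -
    have "?D h = ?D (\<Sum>i\<in>UNIV. h $ i *\<^sub>R axis i 1)"
      by (metis (no_types, lifting) basis_expansion scalar_mult_eq_scaleR sum.cong)
    also have "\<dots> = (\<Sum>i\<in>UNIV. h $ i * ?D (axis i 1))"
      using lin by (simp add: linear_sum linear_cmul)
    also have "\<dots> = grad f p \<bullet> h"
      by (simp add: grad_def inner_vec_def mult.commute)
    finally show ?thesis .
  qed
  then have "?D = (\<lambda>h. grad f p \<bullet> h)" by blast
  with D show ?thesis by metis
qed

lemma grad_eqI:
  fixes f :: "real^'n \<Rightarrow> real"
  assumes "(f has_derivative (\<lambda>h. g \<bullet> h)) (at p)"
  shows "grad f p = g"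
proof -
  have "frechet_derivative f (at p) = (\<lambda>h. g \<bullet> h)"
    using frechet_derivative_at[OF assms] by simp
  then show ?thesis
    by (simp add: grad_def vec_eq_iff inner_axis)
qed

lemma has_derivative_hess:
  fixes f :: "real^'n \<Rightarrow> real"
  assumes "Ck (Suc (Suc k)) f S" "p \<in> S"
  shows "(grad f has_derivative (\<lambda>h. hess f p *v h)) (at p)"
proof -
  have "grad f differentiable (at p)"
    unfolding differentiable_componentwise_within[of "grad f"]
    using assms by (auto simp: grad_def Basis_vec_def inner_axis)
  then show ?thesis
    unfolding hess_def by (simp flip: jacobian_works)
qed

section \<open>Convexity of the anisotropy\<close>

context
  fixes \<phi> :: "real^'n \<Rightarrow> real"
  assumes ani: "anisotropy \<phi>"
begin

lemma anisotropy_homogeneous: "\<phi> (l *\<^sub>R p) = \<bar>l\<bar> * \<phi> p"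
  using ani by (simp add: anisotropy_def)

lemma anisotropy_nonneg: "0 \<le> \<phi> p"
  using ani by (simp add: anisotropy_def)

lemma anisotropy_Ck2: "Ck (Suc (Suc 2)) \<phi> (UNIV - {0})"
  using ani by (simp add: anisotropy_def numeral_eq_Suc)

lemma anisotropy_has_derivative:
  assumes "p \<noteq> 0"
  shows "(\<phi> has_derivative (\<lambda>h. grad \<phi> p \<bullet> h)) (at p)"
  using assms anisotropy_Ck2 by (intro has_derivative_grad) (auto simp only: Ck.simps)

lemma anisotropy_has_hess:
  assumes "p \<noteq> 0"
  shows "(grad \<phi> has_derivative (\<lambda>h. hess \<phi> p *v h)) (at p)"
  using has_derivative_hess[OF anisotropy_Ck2] assms by blast

text \<open>Euler's relation for the \<open>1\<close>-homogeneous \<open>\<phi>\<close>: differentiate \<open>t \<mapsto> \<phi>((1 + t) p)\<close> at \<open>0\<close>.\<close>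

lemma grad_inner_self:
  assumes "p \<noteq> 0"
  shows "grad \<phi> p \<bullet> p = \<phi> p"
proof -
  have "((\<lambda>t::real. \<phi> (t *\<^sub>R p)) has_derivative (\<lambda>t. grad \<phi> p \<bullet> (t *\<^sub>R p))) (at 1)"
    by (rule has_derivative_compose[where g = \<phi> and f = "\<lambda>t. t *\<^sub>R p"])
      (auto intro!: derivative_eq_intros anisotropy_has_derivative simp: assms)
  moreover have "((\<lambda>t::real. \<phi> (t *\<^sub>R p)) has_derivative (\<lambda>t. t * \<phi> p)) (at 1)"
  proof (rule has_derivative_transform_within_open[where f = "\<lambda>t. t * \<phi> p" and s = "{0<..}"])
    show "((\<lambda>t. t * \<phi> p) has_derivative (\<lambda>t. t * \<phi> p)) (at 1)"
      by (auto intro!: derivative_eq_intros)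
  qed (auto simp: anisotropy_homogeneous)
  ultimately have "(\<lambda>t. grad \<phi> p \<bullet> (t *\<^sub>R p)) = (\<lambda>t::real. t * \<phi> p)"
    by (rule has_derivative_unique)
  from fun_cong[OF this, of 1] show ?thesis by simp
qed

lemma grad_homogeneous:
  assumes "p \<noteq> 0" "0 < l"
  shows "grad \<phi> (l *\<^sub>R p) = grad \<phi> p"
proof (rule sym, rule grad_eqI)
  have "((\<lambda>x. \<phi> (l *\<^sub>R x)) has_derivative (\<lambda>h. grad \<phi> (l *\<^sub>R p) \<bullet> (l *\<^sub>R h))) (at p)"
    by (rule has_derivative_compose[where g = \<phi> and f = "\<lambda>x. l *\<^sub>R x"])
      (use assms in \<open>auto intro!: derivative_eq_intros anisotropy_has_derivative\<close>)
  from has_derivative_scaleR_right[OF this, of "inverse l"]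
  show "(\<phi> has_derivative (\<lambda>h. grad \<phi> (l *\<^sub>R p) \<bullet> h)) (at p)"
    using assms by (simp add: anisotropy_homogeneous mult.assoc[symmetric])
qed

lemma hess_homogeneous:
  assumes "p \<noteq> 0" "0 < l"
  shows "hess \<phi> (l *\<^sub>R p) *v (l *\<^sub>R v) = hess \<phi> p *v v"
proof -
  have "((\<lambda>x. grad \<phi> (l *\<^sub>R x)) has_derivative (\<lambda>h. hess \<phi> (l *\<^sub>R p) *v (l *\<^sub>R h))) (at p)"
    by (rule has_derivative_compose[where g = "grad \<phi>" and f = "\<lambda>x. l *\<^sub>R x"])
      (use assms in \<open>auto intro!: derivative_eq_intros anisotropy_has_hess\<close>)
  moreover have "((\<lambda>x. grad \<phi> (l *\<^sub>R x)) has_derivative (\<lambda>h. hess \<phi> p *v h)) (at p)"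
    by (rule has_derivative_transform_within_open[OF anisotropy_has_hess, where s = "- {0}"])
      (use assms in \<open>auto simp: grad_homogeneous\<close>)
  ultimately have "(\<lambda>h. hess \<phi> (l *\<^sub>R p) *v (l *\<^sub>R h)) = (\<lambda>h. hess \<phi> p *v h)"
    by (rule has_derivative_unique)
  then show ?thesis by (rule fun_cong)
qed

text \<open>The gradient is constant along rays, so its derivative vanishes in the radial direction.\<close>

lemma hess_radial:
  assumes "p \<noteq> 0"
  shows "hess \<phi> p *v p = 0"
proof -
  have "((\<lambda>t::real. grad \<phi> (t *\<^sub>R p)) has_derivative (\<lambda>t. hess \<phi> p *v (t *\<^sub>R p))) (at 1)"
    by (rule has_derivative_compose[where g = "grad \<phi>" and f = "\<lambda>t. t *\<^sub>R p"])
      (auto intro!: derivative_eq_intros anisotropy_has_hess simp: assms)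
  moreover have "((\<lambda>t::real. grad \<phi> (t *\<^sub>R p)) has_derivative (\<lambda>t. 0)) (at 1)"
    by (rule has_derivative_transform_within_open[where f = "\<lambda>t. grad \<phi> p" and s = "{0<..}"])
      (auto simp: grad_homogeneous assms)
  ultimately have "(\<lambda>t. hess \<phi> p *v (t *\<^sub>R p)) = (\<lambda>t::real. 0)"
    by (rule has_derivative_unique)
  from fun_cong[OF this, of 1] show ?thesis by simp
qed

text \<open>Differentiating Euler's relation \<open>\<phi>'(p) \<bullet> p = \<phi>(p)\<close> in the direction \<open>v\<close> produces
  \<open>\<phi>'(p) \<bullet> v\<close> on both sides.\<close>

lemma hess_inner_radial:
  assumes "p \<noteq> 0"
  shows "(hess \<phi> p *v v) \<bullet> p = 0"
proof -
  have "((\<lambda>x. grad \<phi> x \<bullet> x) has_derivative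
      (\<lambda>h. grad \<phi> p \<bullet> h + (hess \<phi> p *v h) \<bullet> p)) (at p)"
    by (intro has_derivative_inner anisotropy_has_hess has_derivative_ident assms)
  then have "(\<phi> has_derivative (\<lambda>h. grad \<phi> p \<bullet> h + (hess \<phi> p *v h) \<bullet> p)) (at p)"
    by (rule has_derivative_transform_within_open[where s = "- {0}"])
      (auto simp: grad_inner_self assms)
  then have "(\<lambda>h. grad \<phi> p \<bullet> h + (hess \<phi> p *v h) \<bullet> p) = (\<lambda>h. grad \<phi> p \<bullet> h)"
    by (rule has_derivative_unique[OF _ anisotropy_has_derivative[OF assms]])
  from fun_cong[OF this, of v] show ?thesis by simp
qed

text \<open>Split \<open>v\<close> into its radial and tangential parts at \<open>p\<close>: by the two preceding lemmas only the
  tangential part contributes, and the hypothesis on \<open>\<phi>\<close> applies to that part after normalisation.\<close>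

lemma hess_nonneg:
  assumes "p \<noteq> 0"
  shows "0 \<le> (hess \<phi> p *v v) \<bullet> v"
proof -
  define u where "u = p /\<^sub>R norm p"
  define w where "w = v - (v \<bullet> u) *\<^sub>R u"
  have u: "norm u = 1" "u \<noteq> 0" "p = norm p *\<^sub>R u"
    using assms by (auto simp: u_def)
  have v: "v = w + (v \<bullet> u) *\<^sub>R u" and uw: "u \<bullet> w = 0"
    using u(1) by (auto simp: w_def inner_diff_right inner_commute power2_norm_eq_inner
        simp flip: norm_eq_1)
  have w_nonneg: "0 \<le> (hess \<phi> u *v w) \<bullet> w"
  proof (cases "w = 0")
    case False
    have "norm (w /\<^sub>R norm w) = 1" "u \<bullet> (w /\<^sub>R norm w) = 0"
      using False uw by auto
    then have "0 < (hess \<phi> u *v (w /\<^sub>R norm w)) \<bullet> (w /\<^sub>R norm w)"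
      using ani u(1) unfolding anisotropy_def by blast
    also have "\<dots> = (hess \<phi> u *v w) \<bullet> w / (norm w)\<^sup>2"
      by (simp add: matrix_vector_mult_scaleR power2_eq_square divide_inverse)
    finally show ?thesis
      using False by (simp add: zero_less_divide_iff)
  qed simp
  have "hess \<phi> u *v v = hess \<phi> u *v w"
    by (subst v) (simp add: matrix_vector_right_distrib matrix_vector_mult_scaleR hess_radial u)
  then have "(hess \<phi> u *v v) \<bullet> v = (hess \<phi> u *v w) \<bullet> (w + (v \<bullet> u) *\<^sub>R u)"
    using v by metis
  also have "\<dots> = (hess \<phi> u *v w) \<bullet> w"
    by (simp add: inner_add_right hess_inner_radial u)
  finally have u_nonneg: "0 \<le> (hess \<phi> u *v v) \<bullet> v"
    using w_nonneg by simp
  have "hess \<phi> u *v v = norm p *\<^sub>R (hess \<phi> p *v v)"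
    using hess_homogeneous[of u "norm p" v] u assms
    by (simp add: matrix_vector_mult_scaleR)
  with u_nonneg assms show ?thesis
    by (simp add: zero_le_mult_iff)
qed

text \<open>Since \<open>\<phi>'(a) \<bullet> a = \<phi>(a)\<close>, this is the tangent inequality for \<open>\<phi>\<close> at \<open>a\<close>. The segment
  from \<open>a\<close> to \<open>b\<close> can meet the origin, where \<open>\<phi>\<close> is not differentiable, only if \<open>b\<close> is a multiple
  of \<open>a\<close>, and then homogeneity settles the matter.\<close>

lemma grad_inner_le:
  assumes "a \<noteq> 0"
  shows "grad \<phi> a \<bullet> b \<le> \<phi> b"
proof (cases "\<exists>s. b = s *\<^sub>R a")
  case True
  then obtain s where "b = s *\<^sub>R a" ..
  then show ?thesis
    using assms by (simp add: anisotropy_homogeneous grad_inner_self anisotropy_nonneg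
        mult_right_mono)
next
  case False
  define l where "l t = a + t *\<^sub>R (b - a)" for t :: real
  have l0: "l t \<noteq> 0" for t
  proof
    assume l: "l t = 0"
    then have "t *\<^sub>R b = (t - 1) *\<^sub>R a"
      by (simp add: l_def algebra_simps)
    moreover have "t \<noteq> 0"
      using l assms by (auto simp: l_def)
    ultimately have "b = ((t - 1) / t) *\<^sub>R a"
      by (metis divideR_right scaleR_scaleR divide_inverse mult.commute)
    with False show False by blast
  qed
  have l': "(l has_derivative (\<lambda>s. s *\<^sub>R (b - a))) (at t)" for t
    unfolding l_def by (auto intro!: derivative_eq_intros)
  have "(grad \<phi> (l 0) \<bullet> (b - a)) * (1 - 0) \<le> \<phi> (l 1) - \<phi> (l 0)"
  proof (rule f''_imp_f'[where C = UNIV and f = "\<lambda>t. \<phi> (l t)"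
        and f'' = "\<lambda>t. (hess \<phi> (l t) *v (b - a)) \<bullet> (b - a)"])
    fix t :: real
    show "DERIV (\<lambda>t. \<phi> (l t)) t :> grad \<phi> (l t) \<bullet> (b - a)"
      using has_derivative_compose[OF l' anisotropy_has_derivative[OF l0]]
      by (simp add: has_field_derivative_def mult_commute_abs)
    have "((\<lambda>t. grad \<phi> (l t) \<bullet> (b - a)) has_derivative
        (\<lambda>s. (hess \<phi> (l t) *v (s *\<^sub>R (b - a))) \<bullet> (b - a))) (at t)"
      by (intro has_derivative_inner_left has_derivative_compose[OF l' anisotropy_has_hess[OF l0]])
    then show "DERIV (\<lambda>t. grad \<phi> (l t) \<bullet> (b - a)) t :> (hess \<phi> (l t) *v (b - a)) \<bullet> (b - a)"
      by (simp add: has_field_derivative_def matrix_vector_mult_scaleR mult_commute_abs)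
    show "0 \<le> (hess \<phi> (l t) *v (b - a)) \<bullet> (b - a)"
      by (rule hess_nonneg[OF l0])
  qed auto
  then show ?thesis
    using assms by (simp add: l_def inner_diff_right grad_inner_self)
qed

section \<open>Convexity of \<open>\<Phi>\<close>\<close>

lemma grad_Phi:
  assumes "p \<noteq> 0"
  shows "grad (Phi \<phi>) p = \<phi> p *\<^sub>R grad \<phi> p"
proof (rule grad_eqI)
  show "(Phi \<phi> has_derivative (\<lambda>h. (\<phi> p *\<^sub>R grad \<phi> p) \<bullet> h)) (at p)"
    unfolding Phi_def
    by (auto intro!: derivative_eq_intros anisotropy_has_derivative[OF assms])
qed

text \<open>By homogeneity and compactness of the unit sphere, \<open>\<phi>(h) / \<bar>h\<bar>\<close> stays bounded as \<open>h\<close> tends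
  to \<open>0\<close>, while \<open>\<phi>(h)\<close> tends to \<open>0\<close>; hence \<open>\<Phi>(h) = o(\<bar>h\<bar>)\<close>.\<close>

lemma grad_Phi_0: "grad (Phi \<phi>) 0 = 0"
proof (rule grad_eqI)
  have \<phi>0: "\<phi> 0 = 0"
    using anisotropy_homogeneous[of 0 0] by simp
  have "isCont \<phi> 0"
    using ani by (simp add: anisotropy_def continuous_on_eq_continuous_at)
  then have lim: "(\<phi> \<longlongrightarrow> 0) (at 0)"
    by (simp add: isCont_def \<phi>0)
  have "bounded (\<phi> ` sphere 0 1)"
    using ani by (intro compact_imp_bounded compact_continuous_image)
      (auto simp: anisotropy_def intro: continuous_on_subset)
  then obtain C where C: "\<And>u. norm u = 1 \<Longrightarrow> \<bar>\<phi> u\<bar> \<le> C"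
    by (auto simp: bounded_iff sphere_def)
  have "((\<lambda>h. Phi \<phi> h / norm h) \<longlongrightarrow> 0) (at 0)"
  proof (rule tendsto_0_le[where K = C])
    show "((\<lambda>h. \<phi> h / 2) \<longlongrightarrow> 0) (at 0)"
      using tendsto_divide[OF lim tendsto_const[of 2]] by simp
    have "norm (Phi \<phi> h / norm h) \<le> norm (\<phi> h / 2) * C" if "h \<noteq> 0" for h
    proof -
      have "\<phi> h / norm h = \<phi> (h /\<^sub>R norm h)"
        by (simp add: anisotropy_homogeneous divide_inverse mult.commute)
      also have "\<dots> \<le> C"
        using C[of "h /\<^sub>R norm h"] that by simp
      finally have "\<phi> h / 2 * (\<phi> h / norm h) \<le> \<phi> h / 2 * C"
        by (intro mult_left_mono) (simp_all add: anisotropy_nonneg)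
      then show ?thesis
        by (simp add: Phi_def power2_eq_square anisotropy_nonneg)
    qed
    then show "\<forall>\<^sub>F h in at 0. norm (Phi \<phi> h / norm h) \<le> norm (\<phi> h / 2) * C"
      by (simp add: eventually_at_filter)
  qed
  then show "(Phi \<phi> has_derivative (\<lambda>h. 0 \<bullet> h)) (at 0)"
    by (simp add: has_derivative_at Phi_def \<phi>0)
qed

lemma Phi_above_tangent: "Phi \<phi> a + grad (Phi \<phi>) a \<bullet> (b - a) \<le> Phi \<phi> b"
proof (cases "a = 0")
  case True
  have "\<phi> 0 = 0"
    using anisotropy_homogeneous[of 0 0] by simp
  then show ?thesis
    by (simp add: True grad_Phi_0 Phi_def)
next
  case False
  have "Phi \<phi> a + grad (Phi \<phi>) a \<bullet> (b - a) = \<phi> a * (grad \<phi> a \<bullet> b) - (\<phi> a)\<^sup>2 / 2"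
    using False by (simp add: Phi_def grad_Phi inner_diff_right grad_inner_self power2_eq_square
        algebra_simps)
  also have "\<dots> \<le> \<phi> a * \<phi> b - (\<phi> a)\<^sup>2 / 2"
    using mult_left_mono[OF grad_inner_le[OF False] anisotropy_nonneg] by simp
  also have "\<dots> \<le> (\<phi> b)\<^sup>2 / 2"
    using zero_le_power2[of "\<phi> a - \<phi> b"] by (simp add: power2_diff)
  finally show ?thesis
    by (simp add: Phi_def)
qed

end

section \<open>Derivatives of finite element functions\<close>

lemma Vhd_diff:
  assumes "u \<in> Vhd J q" "v \<in> Vhd J q"
  shows "(\<lambda>\<rho>. u \<rho> - v \<rho>) \<in> Vhd J q"
proof -
  have "(\<lambda>\<rho>. f \<rho> - g \<rho>) \<in> Vh J q" if "f \<in> Vh J q" "g \<in> Vh J q" for f g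
  proof -
    have "\<exists>a b. \<forall>\<rho>\<in>{q (j - 1)..q j}. f \<rho> - g \<rho> = a + b * \<rho>" if j: "j \<in> {1..J}" for j
    proof -
      obtain a b a' b' where
        "\<forall>\<rho>\<in>{q (j - 1)..q j}. f \<rho> = a + b * \<rho>" "\<forall>\<rho>\<in>{q (j - 1)..q j}. g \<rho> = a' + b' * \<rho>"
        using \<open>f \<in> Vh J q\<close> \<open>g \<in> Vh J q\<close> j unfolding Vh_def by blast
      then have "\<forall>\<rho>\<in>{q (j - 1)..q j}. f \<rho> - g \<rho> = (a - a') + (b - b') * \<rho>"
        by (simp add: algebra_simps)
      then show ?thesis by blast
    qed
    with that show ?thesis
      by (auto simp: Vh_def periodic1_def intro!: continuous_on_diff)
  qed
  with assms show ?thesis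
    by (simp add: Vhd_def)
qed

lemma Vhd_has_vector_derivative:
  fixes u :: "real \<Rightarrow> real^'n"
  assumes "u \<in> Vhd J q" "j \<in> {1..J}"
  obtains B where "\<And>\<rho>. \<rho> \<in> {q (j - 1)<..<q j} \<Longrightarrow> (u has_vector_derivative B) (at \<rho>)"
proof -
  have "\<forall>i. \<exists>a b. \<forall>\<rho>\<in>{q (j - 1)..q j}. u \<rho> $ i = a + b * \<rho>"
    using assms unfolding Vhd_def Vh_def by blast
  then obtain a b where ab: "\<And>i \<rho>. \<rho> \<in> {q (j - 1)..q j} \<Longrightarrow> u \<rho> $ i = a i + b i * \<rho>"
    by metis
  have "(u has_vector_derivative (\<chi> i. b i)) (at \<rho>)" if "\<rho> \<in> {q (j - 1)<..<q j}" for \<rho>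
  proof (rule has_vector_derivative_transform_within_open[OF _ open_greaterThanLessThan that])
    show "((\<lambda>\<rho>. (\<chi> i. a i) + \<rho> *\<^sub>R (\<chi> i. b i)) has_vector_derivative (\<chi> i. b i)) (at \<rho>)"
      by (auto intro!: derivative_eq_intros)
    show "(\<chi> i. a i) + r *\<^sub>R (\<chi> i. b i) = u r" if "r \<in> {q (j - 1)<..<q j}" for r
      using that ab[of r] by (simp add: vec_eq_iff mult.commute)
  qed
  then show thesis by (rule that)
qed

lemma ddrho_constant_on_cell:
  assumes "u \<in> Vhd J q" "j \<in> {1..J}"
  obtains B where "\<And>\<rho>. \<rho> \<in> {q (j - 1)<..<q j} \<Longrightarrow> ddrho u \<rho> = B"
proof -
  obtain B where "\<And>\<rho>. \<rho> \<in> {q (j - 1)<..<q j} \<Longrightarrow> (u has_vector_derivative B) (at \<rho>)"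
    using Vhd_has_vector_derivative[OF assms] by blast
  then show thesis
    by (intro that[of B]) (simp add: ddrho_def vector_derivative_at)
qed

lemma ddrho_diff_on_cell:
  assumes "u \<in> Vhd J q" "v \<in> Vhd J q" "j \<in> {1..J}" "\<rho> \<in> {q (j - 1)<..<q j}"
  shows "ddrho (\<lambda>\<rho>. u \<rho> - v \<rho>) \<rho> = ddrho u \<rho> - ddrho v \<rho>"
proof -
  obtain B where B: "(u has_vector_derivative B) (at \<rho>)"
    using Vhd_has_vector_derivative[OF assms(1,3)] assms(4) by blast
  obtain B' where B': "(v has_vector_derivative B') (at \<rho>)"
    using Vhd_has_vector_derivative[OF assms(2,3)] assms(4) by blast
  show ?thesis
    using vector_derivative_at[OF B] vector_derivative_at[OF B']
      vector_derivative_at[OF has_vector_derivative_diff[OF B B']]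
    by (simp add: ddrho_def)
qed

text \<open>Every point of \<open>[0,1]\<close> that is not a mesh point lies in the open cell that ends at the first mesh
  point to its right.\<close>

lemma mesh_cells_cover:
  assumes "mesh c J q"
  shows "{0..1} \<subseteq> q ` {..J} \<union> (\<Union>j\<in>{1..J}. {q (j - 1)<..<q j})"
proof
  fix \<rho> :: real assume \<rho>: "\<rho> \<in> {0..1}"
  define j where "j = (LEAST j. \<rho> \<le> q j)"
  have q: "q 0 = 0" "\<rho> \<le> q J"
    using assms \<rho> by (auto simp: mesh_def)
  have j: "\<rho> \<le> q j" "j \<le> J"
    unfolding j_def using q(2) by (auto intro: LeastI Least_le)
  show "\<rho> \<in> q ` {..J} \<union> (\<Union>j\<in>{1..J}. {q (j - 1)<..<q j})"
  proof (cases "\<rho> = q j")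
    case True
    with j(2) show ?thesis by blast
  next
    case False
    have "j \<noteq> 0"
    proof
      assume "j = 0"
      with q(1) \<rho> j(1) False show False by simp
    qed
    then have "q (j - 1) < \<rho>"
      using not_less_Least[of "j - 1" "\<lambda>j. \<rho> \<le> q j"] by (simp flip: j_def)
    then have "\<rho> \<in> {q (j - 1)<..<q j}" "j \<in> {1..J}"
      using j False \<open>j \<noteq> 0\<close> by auto
    then show ?thesis by blast
  qed
qed

text \<open>Up to the mesh points, such a function is a finite combination of indicators of cells.\<close>

lemma set_integrable_cellwise_constant:
  fixes f :: "real \<Rightarrow> real"
  assumes mesh: "mesh c J q"
    and const: "\<And>j. j \<in> {1..J} \<Longrightarrow> \<exists>C. \<forall>\<rho>\<in>{q (j - 1)<..<q j}. f \<rho> = C"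
  shows "set_integrable lebesgue {0..1} f"
proof -
  have cell: "set_integrable lebesgue {q (j - 1)<..<q j} f" if "j \<in> {1..J}" for j
  proof -
    obtain C where "\<forall>\<rho>\<in>{q (j - 1)<..<q j}. f \<rho> = C"
      using const \<open>j \<in> {1..J}\<close> by blast
    then have "\<And>\<rho>. \<rho> \<in> {q (j - 1)<..<q j} \<Longrightarrow> f \<rho> = C"
      by blast
    moreover have "set_integrable lebesgue {q (j - 1)<..<q j} (\<lambda>_. C)"
      using absolutely_integrable_on_const[of "{q (j - 1)<..<q j}" C] by simp
    ultimately show ?thesis
      using set_integrable_cong[of lebesgue lebesgue "{q (j - 1)<..<q j}" "{q (j - 1)<..<q j}" f "\<lambda>_. C"]
      by metis
  qed
  have "set_integrable lebesgue (q ` {..J}) f"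
    by (rule absolutely_integrable_negligible) (simp add: negligible_finite)
  moreover have "set_integrable lebesgue (\<Union>j\<in>{1..J}. {q (j - 1)<..<q j}) f"
    by (rule set_integrable_UN) (use cell in \<open>auto simp del: One_nat_def\<close>)
  ultimately have "set_integrable lebesgue (q ` {..J} \<union> (\<Union>j\<in>{1..J}. {q (j - 1)<..<q j})) f"
    by (rule set_integrable_Un) (auto intro: negligible_imp_sets negligible_finite)
  then show ?thesis
    by (rule set_integrable_subset) (simp, rule mesh_cells_cover[OF mesh])
qed

lemma AE_in_cell:
  assumes "mesh c J q"
    and "\<And>j \<rho>. j \<in> {1..J} \<Longrightarrow> \<rho> \<in> {q (j - 1)<..<q j} \<Longrightarrow> P \<rho>"
  shows "AE \<rho> in lebesgue. \<rho> \<in> {0..1} \<longrightarrow> P \<rho>"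
proof (rule AE_I')
  show "q ` {..J} \<in> null_sets lebesgue"
    using negligible_finite[of "q ` {..J}"] by (simp add: negligible_iff_null_sets)
  show "{\<rho> \<in> space lebesgue. \<not> (\<rho> \<in> {0..1} \<longrightarrow> P \<rho>)} \<subseteq> q ` {..J}"
    using mesh_cells_cover[OF assms(1)] assms(2) by blast
qed

section \<open>The energy estimate\<close>

text \<open>The integrated tangent inequality. The derivative of \<open>u - v\<close> is not expanded, because in this form
  the second integral is what the scheme yields when it is tested with \<open>u - v\<close>.\<close>

lemma Phi_energy_difference:
  fixes u v :: "real \<Rightarrow> real^'n"
  assumes ani: "anisotropy \<phi>" and mesh: "mesh c J q"
    and u: "u \<in> Vhd J q" and v: "v \<in> Vhd J q"
  shows "(LINT \<rho>:{0..1}|lebesgue. Phi \<phi> (ddrho u \<rho>))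
      - (LINT \<rho>:{0..1}|lebesgue. grad (Phi \<phi>) (ddrho u \<rho>) \<bullet> ddrho (\<lambda>\<rho>. u \<rho> - v \<rho>) \<rho>)
    \<le> (LINT \<rho>:{0..1}|lebesgue. Phi \<phi> (ddrho v \<rho>))"
proof -
  let ?w = "\<lambda>\<rho>. u \<rho> - v \<rho>"
  have Phi_int: "set_integrable lebesgue {0..1} (\<lambda>\<rho>. Phi \<phi> (ddrho y \<rho>))" if "y \<in> Vhd J q" for y
    by (rule set_integrable_cellwise_constant[OF mesh]) (metis ddrho_constant_on_cell[OF that])
  have grad_int:
    "set_integrable lebesgue {0..1} (\<lambda>\<rho>. grad (Phi \<phi>) (ddrho u \<rho>) \<bullet> ddrho ?w \<rho>)"
    by (rule set_integrable_cellwise_constant[OF mesh])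
      (metis ddrho_constant_on_cell[OF u] ddrho_constant_on_cell[OF Vhd_diff[OF u v]])
  have "(LINT \<rho>:{0..1}|lebesgue. Phi \<phi> (ddrho u \<rho>) - grad (Phi \<phi>) (ddrho u \<rho>) \<bullet> ddrho ?w \<rho>)
      \<le> (LINT \<rho>:{0..1}|lebesgue. Phi \<phi> (ddrho v \<rho>))"
  proof (rule set_integral_mono_AE)
    show "AE \<rho>\<in>{0..1} in lebesgue.
        Phi \<phi> (ddrho u \<rho>) - grad (Phi \<phi>) (ddrho u \<rho>) \<bullet> ddrho ?w \<rho> \<le> Phi \<phi> (ddrho v \<rho>)"
    proof (rule AE_in_cell[OF mesh])
      fix j \<rho> assume "j \<in> {1..J}" "\<rho> \<in> {q (j - 1)<..<q j}"
      then have "ddrho ?w \<rho> = ddrho u \<rho> - ddrho v \<rho>"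
        by (rule ddrho_diff_on_cell[OF u v])
      then show "Phi \<phi> (ddrho u \<rho>) - grad (Phi \<phi>) (ddrho u \<rho>) \<bullet> ddrho ?w \<rho> \<le> Phi \<phi> (ddrho v \<rho>)"
        using Phi_above_tangent[OF ani, of "ddrho u \<rho>" "ddrho v \<rho>"]
        by (simp add: inner_diff_right)
    qed
  qed (intro set_integral_diff Phi_int grad_int u v)+
  then show ?thesis
    by (simp add: set_integral_diff Phi_int grad_int u)
qed

theorem theorem3p1:
  fixes \<phi> \<mm> :: "real^'n \<Rightarrow> real"
    and c T \<Delta>t :: real
    and J M :: nat
    and q :: "nat \<Rightarrow> real"
    and x0 :: "real \<Rightarrow> real^'n"
    and x :: "nat \<Rightarrow> real \<Rightarrow> real^'n"
  assumes "CARD('n) \<ge> 2"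
    and "anisotropy \<phi>"
    and "mobility \<mm>"
    and "c > 0" and "mesh c J q"
    and "T > 0" and "M > 0" and "\<Delta>t = T / real M"
    and "Winf 2 x0"
    and "\<exists>\<delta>>0. AE \<rho> in lebesgue. \<delta> \<le> norm (wderiv x0 \<rho>)"
    and "\<forall>m\<le>M. x m \<in> Vhd J q"
    and "\<forall>m<M. AE \<rho> in lebesgue. \<rho> \<in> {0..1} \<longrightarrow> ddrho (x m) \<rho> \<noteq> 0"
    and "x 0 = Qh \<phi> J q x0"
    and "\<forall>m<M. \<forall>\<eta>\<in>Vhd J q.
           1 / \<Delta>t * (LINT \<rho>:{0..1}|lebesgue.
              (Hmat \<phi> \<mm> (ddrho (x m) \<rho>) *v (x (Suc m) \<rho> - x m \<rho>)) \<bullet> \<eta> \<rho>)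
           + (LINT \<rho>:{0..1}|lebesgue. grad (Phi \<phi>) (ddrho (x (Suc m)) \<rho>) \<bullet> ddrho \<eta> \<rho>) = 0"
  shows "\<forall>m<M.
           (LINT \<rho>:{0..1}|lebesgue. Phi \<phi> (ddrho (x (Suc m)) \<rho>))
           + 1 / \<Delta>t * (LINT \<rho>:{0..1}|lebesgue.
              (Hmat \<phi> \<mm> (ddrho (x m) \<rho>) *v (x (Suc m) \<rho> - x m \<rho>)) \<bullet> (x (Suc m) \<rho> - x m \<rho>))
           \<le> (LINT \<rho>:{0..1}|lebesgue. Phi \<phi> (ddrho (x m) \<rho>))"
proof (intro allI impI)
  fix m assume m: "m < M"
  let ?w = "\<lambda>\<rho>. x (Suc m) \<rho> - x m \<rho>"
  have x: "x (Suc m) \<in> Vhd J q" "x m \<in> Vhd J q"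
    using assms(11) m by auto
  then have "?w \<in> Vhd J q"
    by (rule Vhd_diff)
  then have
    "1 / \<Delta>t * (LINT \<rho>:{0..1}|lebesgue. (Hmat \<phi> \<mm> (ddrho (x m) \<rho>) *v ?w \<rho>) \<bullet> ?w \<rho>)
      + (LINT \<rho>:{0..1}|lebesgue. grad (Phi \<phi>) (ddrho (x (Suc m)) \<rho>) \<bullet> ddrho ?w \<rho>) = 0"
    by (rule assms(14)[rule_format, OF m])
  with Phi_energy_difference[OF assms(2,5) x]
  show "(LINT \<rho>:{0..1}|lebesgue. Phi \<phi> (ddrho (x (Suc m)) \<rho>))
      + 1 / \<Delta>t * (LINT \<rho>:{0..1}|lebesgue. (Hmat \<phi> \<mm> (ddrho (x m) \<rho>) *v ?w \<rho>) \<bullet> ?w \<rho>)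
    \<le> (LINT \<rho>:{0..1}|lebesgue. Phi \<phi> (ddrho (x m) \<rho>))"
    by linarith
qed

end
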